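(* Let $R\subseteq E$ be Lie conformal algebras ($R$ a subalgebra of $E$), and let $Q$ be a complement of $R$ in $E$, with associated matched pair of Lie conformal algebras $(R,Q,\lhd_\lambda,\rhd_\lambda)$. Then a Lie conformal algebra $\overline{Q}$ is a complement of $R$ in $E$ if and only if there exists a deformation map $\varphi: Q\to R$ of $(R,Q,\lhd_\lambda,\rhd_\lambda)$ such that $\overline{Q}\cong Q_\varphi$ (isomorphism of Lie conformal algebras).
   Context: All vector spaces are over $\mathbb{C}$, and for a vector space $A$, $A[\lambda]$ denotes the space of polynomials in $\lambda$ with coefficients in $A$. A Lie conformal algebra is a $\mathbb{C}[\partial]$-module $R$ with a $\mathbb{C}$-bilinear map $[\cdot_\lambda\cdot]: R\times R\to R[\lambda]$ satisfying $[\partial a_\lambda b]=-\lambda[a_\lambda b]$, $[a_\lambda \partial b]=(\partial+\lambda)[a_\lambda b]$, $[a_\lambda b]=-[b_{-\lambda-\partial}a]$ and $[a_\lambda[b_\mu c]]=[[a_\lambda b]_{\lambda+\mu}c]+[b_\mu[a_\lambda c]]$ for all $a,b,c\in R$. Convention: if $u\ast_\lambda v=\sum_n \lambda^n w_n$, then $u\ast_{-\lambda-\partial}v:=\sum_n(-\lambda-\partial)^n w_n$. $\mathbb{C}[\partial]$-module maps are extended coefficientwise to polynomials in $\lambda$. Homomorphisms of Lie conformal algebras are $\mathbb{C}[\partial]$-module maps preserving $\lambda$-brackets. A complement of a subalgebra $R$ in $E$ is a subalgebra $Q$ of $E$ such that $E=R\oplus Q$ as $\mathbb{C}[\partial]$-modules.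 Elements of $E=R\oplus Q$ are written $a\oplus x$ with $a\in R$, $x\in Q$. The associated matched pair $(R,Q,\lhd_\lambda,\rhd_\lambda)$ consists of the operations $\rhd_\lambda: Q\times R\to R[\lambda]$ and $\lhd_\lambda: Q\times R\to Q[\lambda]$ determined by $[x_\lambda a]=(x\rhd_\lambda a)\oplus(x\lhd_\lambda a)$ for $x\in Q$, $a\in R$. The bracket of $E$ is then that of the bicrossed product of $R$ and $Q$: $$[(a\oplus x)_\lambda (b\oplus y)]=([a_\lambda b]+x\rhd_\lambda b-y\rhd_{-\lambda-\partial} a)\oplus([x_\lambda y]+x\lhd_\lambda b-y\lhd_{-\lambda-\partial} a).$$ A deformation map of $(R,Q,\lhd_\lambda,\rhd_\lambda)$ is a $\mathbb{C}[\partial]$-module homomorphism $\varphi:Q\to R$ such that for all $x,y\in Q$ $$\varphi([x_\lambda y])-[\varphi(x)_\lambda\varphi(y)]=\varphi(y\lhd_{-\lambda-\partial}\varphi(x))-\varphi(x\lhd_\lambda\varphi(y))+x\rhd_\lambda\varphi(y)-y\rhd_{-\lambda-\partial}\varphi(x).$$ For a deformation map $\varphi$, the $\varphi$-deformation $Q_\varphi$ of $Q$ is the $\mathbb{C}[\partial]$-module $Q$ with the $\lambda$-bracket $[x_\lambda y]_\varphi:=[x_\lambda y]+x\lhd_\lambda\varphi(y)-y\lhd_{-\lambda-\partial}\varphi(x)$, which is a Lie conformal algebra.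
   Formalization: "Q̄ is a complement of R in E" is read as "Q̄ is isomorphic to a complement of R in E"; read literally, the "if" direction fails, e.g. for E = R ⊕ Q with R and Q isomorphic abelian algebras, Q̄ = R and φ = 0. *)

theory Defs
  imports Complex_Main "HOL-Computational_Algebra.Polynomial"
begin

text \<open>
  Structures live on a carrier inside an ambient complex vector space: addition is that of the
  type, scalar multiplication by \<open>scal\<close>. The element \<open>\<Sum>\<^sub>n \<lambda>\<^sup>n w\<^sub>n\<close> of \<open>A[\<lambda>]\<close> is the library
  polynomial whose \<open>n\<close>-th coefficient is \<open>w\<^sub>n\<close>; multiplication by \<open>\<lambda>\<close> is \<open>pCons 0\<close>, and a linear
  map is extended coefficientwise by \<open>map_poly\<close>.
\<close>

record (overloaded) ('a::ab_group_add) lca =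
  carrier :: "'a set"
  scal :: "complex \<Rightarrow> 'a \<Rightarrow> 'a"
  der :: "'a \<Rightarrow> 'a"
  lbr :: "'a \<Rightarrow> 'a \<Rightarrow> 'a poly"

text \<open>
  \<open>psub T i (\<Sum>\<^sub>n \<lambda>\<^sup>n w\<^sub>n) = \<Sum>\<^sub>n T\<^sup>n (i w\<^sub>n)\<close>: the variable is replaced by the operator \<open>T\<close>, after
  the coefficients have been sent by \<open>i\<close> to the space on which \<open>T\<close> acts.
\<close>

definition psub :: "('m::comm_monoid_add \<Rightarrow> 'm) \<Rightarrow> ('a::zero \<Rightarrow> 'm) \<Rightarrow> 'a poly \<Rightarrow> 'm" where
  "psub T i p = (\<Sum>n\<le>degree p. (T ^^ n) (i (coeff p n)))"

text \<open>The substitution of \<open>-\<lambda>-\<partial>\<close> for \<open>\<lambda>\<close>.\<close>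

definition flip :: "('a::ab_group_add \<Rightarrow> 'a) \<Rightarrow> 'a poly \<Rightarrow> 'a poly" where
  "flip d = psub (\<lambda>q. - pCons 0 q - map_poly d q) (\<lambda>w. [:w:])"

text \<open>
  \<open>A[\<lambda>,\<mu>]\<close> is rendered as polynomials in \<open>\<mu>\<close> with coefficients in \<open>A[\<lambda>]\<close>. The following are the
  multiplications by \<open>\<lambda>\<close> and by \<open>\<mu>\<close>, and the inclusion of \<open>A\<close>.
\<close>

definition mul_lam :: "'a::ab_group_add poly poly \<Rightarrow> 'a poly poly" where
  "mul_lam P = map_poly (pCons 0) P"

definition mul_mu :: "'a::ab_group_add poly poly \<Rightarrow> 'a poly poly" where
  "mul_mu P = pCons 0 P"

definition const2 :: "'a::ab_group_add \<Rightarrow> 'a poly poly" where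
  "const2 w = [:[:w:]:]"

text \<open>\<open>\<complex>[\<partial>]\<close>-modules: complex vector spaces with a linear endomorphism.\<close>

locale cd_module = vector_space "scal M" for M :: "'a::ab_group_add lca" +
  assumes carrier_subspace: "subspace (carrier M)"
    and der_closed: "a \<in> carrier M \<Longrightarrow> der M a \<in> carrier M"
    and der_add: "a \<in> carrier M \<Longrightarrow> b \<in> carrier M \<Longrightarrow> der M (a + b) = der M a + der M b"
    and der_scal: "a \<in> carrier M \<Longrightarrow> der M (scal M s a) = scal M s (der M a)"

text \<open>
  In \<open>lbr_jacobi\<close> the three terms are \<open>[a\<^sub>\<lambda>[b\<^sub>\<mu>c]]\<close>, \<open>[[a\<^sub>\<lambda>b]\<^bsub>\<lambda>+\<mu>\<^esub>c]\<close> and \<open>[b\<^sub>\<mu>[a\<^sub>\<lambda>c]]\<close>; the outer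
  \<open>psub\<close> runs over the coefficients of the inner bracket.
\<close>

locale lie_conformal_algebra = cd_module L for L :: "'a::ab_group_add lca" +
  assumes lbr_closed: "a \<in> carrier L \<Longrightarrow> b \<in> carrier L \<Longrightarrow> coeff (lbr L a b) n \<in> carrier L"
    and lbr_add_left: "a \<in> carrier L \<Longrightarrow> b \<in> carrier L \<Longrightarrow> c \<in> carrier L \<Longrightarrow>
      lbr L (a + b) c = lbr L a c + lbr L b c"
    and lbr_add_right: "a \<in> carrier L \<Longrightarrow> b \<in> carrier L \<Longrightarrow> c \<in> carrier L \<Longrightarrow>
      lbr L a (b + c) = lbr L a b + lbr L a c"
    and lbr_scal_left: "a \<in> carrier L \<Longrightarrow> b \<in> carrier L \<Longrightarrow>
      lbr L (scal L s a) b = map_poly (scal L s) (lbr L a b)"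
    and lbr_scal_right: "a \<in> carrier L \<Longrightarrow> b \<in> carrier L \<Longrightarrow>
      lbr L a (scal L s b) = map_poly (scal L s) (lbr L a b)"
    and lbr_der_left: "a \<in> carrier L \<Longrightarrow> b \<in> carrier L \<Longrightarrow>
      lbr L (der L a) b = - pCons 0 (lbr L a b)"
    and lbr_der_right: "a \<in> carrier L \<Longrightarrow> b \<in> carrier L \<Longrightarrow>
      lbr L a (der L b) = map_poly (der L) (lbr L a b) + pCons 0 (lbr L a b)"
    and lbr_skew: "a \<in> carrier L \<Longrightarrow> b \<in> carrier L \<Longrightarrow>
      lbr L a b = - flip (der L) (lbr L b a)"
    and lbr_jacobi: "a \<in> carrier L \<Longrightarrow> b \<in> carrier L \<Longrightarrow> c \<in> carrier L \<Longrightarrow>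
      psub mul_mu (\<lambda>w. psub mul_lam const2 (lbr L a w)) (lbr L b c) =
      psub mul_lam (\<lambda>w. psub (\<lambda>P. mul_lam P + mul_mu P) const2 (lbr L w c)) (lbr L a b) +
      psub mul_lam (\<lambda>w. psub mul_mu const2 (lbr L b w)) (lbr L a c)"

definition cd_hom :: "'a::ab_group_add lca \<Rightarrow> 'b::ab_group_add lca \<Rightarrow> ('a \<Rightarrow> 'b) \<Rightarrow> bool" where
  "cd_hom M N f \<longleftrightarrow>
     (\<forall>a\<in>carrier M. f a \<in> carrier N) \<and>
     (\<forall>a\<in>carrier M. \<forall>b\<in>carrier M. f (a + b) = f a + f b) \<and>
     (\<forall>s. \<forall>a\<in>carrier M. f (scal M s a) = scal N s (f a)) \<and>
     (\<forall>a\<in>carrier M. f (der M a) = der N (f a))"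

definition lca_hom :: "'a::ab_group_add lca \<Rightarrow> 'b::ab_group_add lca \<Rightarrow> ('a \<Rightarrow> 'b) \<Rightarrow> bool" where
  "lca_hom L K f \<longleftrightarrow> cd_hom L K f \<and>
     (\<forall>a\<in>carrier L. \<forall>b\<in>carrier L. map_poly f (lbr L a b) = lbr K (f a) (f b))"

definition lca_isomorphic :: "'a::ab_group_add lca \<Rightarrow> 'b::ab_group_add lca \<Rightarrow> bool" where
  "lca_isomorphic L K \<longleftrightarrow> (\<exists>f. lca_hom L K f \<and> bij_betw f (carrier L) (carrier K))"

text \<open>A subalgebra is given by its carrier; as an algebra it is \<open>restr E S\<close>.\<close>

definition restr :: "'a::ab_group_add lca \<Rightarrow> 'a set \<Rightarrow> 'a lca" where
  "restr E S = E\<lparr>carrier := S\<rparr>"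

definition subalgebra :: "'a set \<Rightarrow> 'a::ab_group_add lca \<Rightarrow> bool" where
  "subalgebra S E \<longleftrightarrow> S \<subseteq> carrier E \<and> module.subspace (scal E) S \<and>
     (\<forall>a\<in>S. der E a \<in> S) \<and> (\<forall>a\<in>S. \<forall>b\<in>S. \<forall>n. coeff (lbr E a b) n \<in> S)"

text \<open>
  Both summands being submodules, \<open>E = R \<oplus> Q\<close> as \<open>\<complex>[\<partial>]\<close>-modules is the internal direct sum.
\<close>

definition complement :: "'a::ab_group_add lca \<Rightarrow> 'a set \<Rightarrow> 'a set \<Rightarrow> bool" where
  "complement E R Q \<longleftrightarrow> subalgebra Q E \<and>
     carrier E = {a + x |a x. a \<in> R \<and> x \<in> Q} \<and> R \<inter> Q = {0}"

text \<open>\<open>dproj A B\<close> is the projection of \<open>A \<oplus> B\<close> onto \<open>A\<close>.\<close>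

definition dproj :: "'a::ab_group_add set \<Rightarrow> 'a set \<Rightarrow> 'a \<Rightarrow> 'a" where
  "dproj A B e = (THE a. a \<in> A \<and> (\<exists>x\<in>B. e = a + x))"

text \<open>The operations \<open>x \<rhd>\<^sub>\<lambda> a\<close> and \<open>x \<lhd>\<^sub>\<lambda> a\<close>: the components of \<open>[x\<^sub>\<lambda>a]\<close> in \<open>R[\<lambda>]\<close> and \<open>Q[\<lambda>]\<close>.\<close>

definition mp_rhd :: "'a::ab_group_add lca \<Rightarrow> 'a set \<Rightarrow> 'a set \<Rightarrow> 'a \<Rightarrow> 'a \<Rightarrow> 'a poly" where
  "mp_rhd E R Q x a = map_poly (dproj R Q) (lbr E x a)"

definition mp_lhd :: "'a::ab_group_add lca \<Rightarrow> 'a set \<Rightarrow> 'a set \<Rightarrow> 'a \<Rightarrow> 'a \<Rightarrow> 'a poly" where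
  "mp_lhd E R Q x a = map_poly (dproj Q R) (lbr E x a)"

lemma dproj_decomp:
  assumes R: "module.subspace (scal E) R" and V: "vector_space (scal E)"
    and C: "complement E R Q" and e: "e \<in> carrier E"
  shows "dproj R Q e \<in> R" "dproj Q R e \<in> Q" "dproj R Q e + dproj Q R e = e"
proof -
  interpret vector_space "scal E" by (rule V)
  have Q: "subspace Q" and cap: "R \<inter> Q = {0}"
    using C by (auto simp: complement_def subalgebra_def)
  obtain a x where ax: "a \<in> R" "x \<in> Q" "e = a + x"
    using C e by (auto simp: complement_def)
  have uniq: "b = a \<and> y = x" if "b \<in> R" "y \<in> Q" "e = b + y" for b y
  proof -
    have "b - a = x - y" using that ax by (simp add: algebra_simps)
    moreover have "b - a \<in> R" "x - y \<in> Q"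
      using that ax R Q by (auto intro: subspace_diff)
    ultimately have "b - a \<in> R \<inter> Q" by simp
    then have "b - a = 0" unfolding cap by simp
    with \<open>b - a = x - y\<close> show ?thesis by simp
  qed
  have 1: "dproj R Q e = a"
    unfolding dproj_def
  proof (rule the_equality)
    show "a \<in> R \<and> (\<exists>x\<in>Q. e = a + x)" using ax by blast
    show "b = a" if "b \<in> R \<and> (\<exists>x\<in>Q. e = b + x)" for b using that uniq by blast
  qed
  have 2: "dproj Q R e = x"
    unfolding dproj_def
  proof (rule the_equality)
    show "x \<in> Q \<and> (\<exists>a\<in>R. e = x + a)" using ax by (metis add.commute)
    show "y = x" if "y \<in> Q \<and> (\<exists>b\<in>R. e = y + b)" for y
      using that uniq by (metis add.commute)
  qed
  show "dproj R Q e \<in> R" "dproj Q R e \<in> Q" "dproj R Q e + dproj Q R e = e"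
    unfolding 1 2 using ax by simp_all
qed

text \<open>The defining relation \<open>[x\<^sub>\<lambda>a] = (x \<rhd>\<^sub>\<lambda> a) \<oplus> (x \<lhd>\<^sub>\<lambda> a)\<close> of the associated matched pair.\<close>

lemma matched_pair_decomp:
  assumes E: "lie_conformal_algebra E" and R: "subalgebra R E" and C: "complement E R Q"
    and x: "x \<in> Q" and a: "a \<in> R"
  shows "coeff (mp_rhd E R Q x a) n \<in> R" "coeff (mp_lhd E R Q x a) n \<in> Q"
    "lbr E x a = mp_rhd E R Q x a + mp_lhd E R Q x a"
proof -
  interpret lie_conformal_algebra E by (rule E)
  have V: "vector_space (scal E)" by unfold_locales
  have R': "subspace R" and Q': "subspace Q"
    using R C by (auto simp: complement_def subalgebra_def)
  note D = dproj_decomp[OF R' V C]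
  have x': "x \<in> carrier E" and a': "a \<in> carrier E"
    using R C x a by (auto simp: complement_def subalgebra_def)
  have c: "coeff (lbr E x a) k \<in> carrier E" for k
    using lbr_closed[OF x' a'] .
  have D0: "dproj R Q 0 \<in> R" "dproj Q R 0 \<in> Q" "dproj R Q 0 + dproj Q R 0 = 0"
    using D[OF subspace_0[OF carrier_subspace]] .
  have "dproj R Q 0 = - dproj Q R 0" using D0(3) by (rule add_eq_0_iff2[THEN iffD1])
  then have "dproj R Q 0 \<in> Q" using subspace_neg[OF Q' D0(2)] by (rule ssubst)
  with D0(1) have "dproj R Q 0 \<in> R \<inter> Q" by (rule IntI)
  then have z1: "dproj R Q 0 = 0"
    using C unfolding complement_def by blast
  have z2: "dproj Q R 0 = 0"
    using D0(3) unfolding z1 by (simp only: add_0)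
  note cf = mp_rhd_def mp_lhd_def coeff_map_poly[of "dproj R Q", OF z1] coeff_map_poly[of "dproj Q R", OF z2]
  show "coeff (mp_rhd E R Q x a) n \<in> R" "coeff (mp_lhd E R Q x a) n \<in> Q"
    unfolding cf by (rule D(1)[OF c], rule D(2)[OF c])
  show "lbr E x a = mp_rhd E R Q x a + mp_lhd E R Q x a"
    by (rule poly_eqI) (simp only: cf coeff_add D(3)[OF c])
qed

definition deformation_map :: "'a::ab_group_add lca \<Rightarrow> 'a set \<Rightarrow> 'a set \<Rightarrow> ('a \<Rightarrow> 'a) \<Rightarrow> bool" where
  "deformation_map E R Q \<phi> \<longleftrightarrow> cd_hom (restr E Q) (restr E R) \<phi> \<and>
     (\<forall>x\<in>Q. \<forall>y\<in>Q.
        map_poly \<phi> (lbr E x y) - lbr E (\<phi> x) (\<phi> y) =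
        map_poly \<phi> (flip (der E) (mp_lhd E R Q y (\<phi> x))) - map_poly \<phi> (mp_lhd E R Q x (\<phi> y))
        + mp_rhd E R Q x (\<phi> y) - flip (der E) (mp_rhd E R Q y (\<phi> x)))"

definition deformed :: "'a::ab_group_add lca \<Rightarrow> 'a set \<Rightarrow> 'a set \<Rightarrow> ('a \<Rightarrow> 'a) \<Rightarrow> 'a lca" where
  "deformed E R Q \<phi> = E\<lparr>carrier := Q,
     lbr := (\<lambda>x y. lbr E x y + mp_lhd E R Q x (\<phi> y) - flip (der E) (mp_lhd E R Q y (\<phi> x)))\<rparr>"

text \<open>
  An abstract algebra \<open>L\<close> is a complement of \<open>R\<close> in \<open>E\<close> when it is identified, as a Lie conformal
  algebra, with a subalgebra of \<open>E\<close> that is a complement. Identifying up to isomorphism is forced: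
  a subalgebra of \<open>E\<close> that is merely isomorphic to a complement need not be one itself.
\<close>

definition is_complement_of :: "'b::ab_group_add lca \<Rightarrow> 'a set \<Rightarrow> 'a::ab_group_add lca \<Rightarrow> bool" where
  "is_complement_of L R E \<longleftrightarrow> (\<exists>P. complement E R P \<and> lca_isomorphic L (restr E P))"

end

theory Submission imports Defs begin

text \<open>
  The complements of \<open>R\<close> in \<open>E = R \<oplus> Q\<close> are exactly the graphs \<open>{\<phi> x + x | x \<in> Q}\<close> of deformation
  maps. As far as \<open>\<complex>[\<partial>]\<close>-modules are concerned, a submodule \<open>P\<close> with \<open>E = R \<oplus> P\<close> meets every coset
  \<open>x + R\<close>, \<open>x \<in> Q\<close>, in a single point \<open>\<phi> x + x\<close>, and the function \<open>\<phi> : Q \<rightarrow> R\<close> so obtained is a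
  module homomorphism (\<open>complement_is_graph\<close>); conversely every graph is a module complement
  (\<open>graph_direct_sum\<close>). By the formula for the bicrossed product, the bracket \<open>[(\<phi> x + x)\<^sub>\<lambda>(\<phi> y + y)]\<close> of
  two points of the graph is \<open>r \<oplus> [x\<^sub>\<lambda>y]\<^sub>\<phi>\<close>, where
  \<open>r = [\<phi>(x)\<^sub>\<lambda>\<phi>(y)] + x \<rhd>\<^sub>\<lambda> \<phi>(y) - y \<rhd>\<^bsub>-\<lambda>-\<partial>\<^esub> \<phi>(x)\<close>. Hence the graph is closed under the bracket
  precisely if \<open>r = \<phi>([x\<^sub>\<lambda>y]\<^sub>\<phi>)\<close>, and this is the equation of a deformation map with its terms
  rearranged (\<open>complement_graph_iff\<close>). The same formula shows that the projection to \<open>Q\<close> carries the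
  bracket of the graph to the bracket of \<open>Q\<^sub>\<phi>\<close> (\<open>graph_isomorphic_deformed\<close>).
\<close>

section \<open>Isomorphisms\<close>

lemma cd_hom_zero:
  assumes "cd_hom M N f" "0 \<in> carrier M"
  shows "f 0 = 0"
proof -
  have "f (0 + 0) = f 0 + f 0"
    using assms unfolding cd_hom_def by blast
  then show ?thesis by simp
qed

lemma lca_isomorphic_trans:
  assumes "lca_isomorphic L K" "lca_isomorphic K M" "0 \<in> carrier L"
  shows "lca_isomorphic L M"
proof -
  obtain f where f: "lca_hom L K f" "bij_betw f (carrier L) (carrier K)"
    using assms(1) by (auto simp: lca_isomorphic_def)
  obtain g where g: "lca_hom K M g" "bij_betw g (carrier K) (carrier M)"
    using assms(2) by (auto simp: lca_isomorphic_def)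
  have f0: "f 0 = 0"
    using cd_hom_zero f(1) assms(3) by (auto simp: lca_hom_def)
  have "0 \<in> carrier K"
    using bij_betwE[OF f(2)] assms(3) f0 by metis
  then have g0: "g 0 = 0"
    using cd_hom_zero g(1) by (auto simp: lca_hom_def)
  have "map_poly (g \<circ> f) p = map_poly g (map_poly f p)" for p
    by (rule poly_eqI) (simp add: coeff_map_poly f0 g0)
  then have "lca_hom L M (g \<circ> f)"
    using f(1) g(1) by (simp add: lca_hom_def cd_hom_def)
  then show ?thesis
    using bij_betw_trans[OF f(2) g(2)] by (auto simp: lca_isomorphic_def)
qed

text \<open>
  The inverse bijection is determined only on the carriers, so that the operations of \<open>L\<close> have to stay
  inside its carrier for the inverse to undo the isomorphism on their values.
\<close>

lemma lca_isomorphic_sym: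
  assumes L: "lie_conformal_algebra L" and iso: "lca_isomorphic L K"
  shows "lca_isomorphic K L"
proof -
  interpret lie_conformal_algebra L by (rule L)
  obtain f where f: "cd_hom L K f" "bij_betw f (carrier L) (carrier K)"
    and br: "\<And>a b. a \<in> carrier L \<Longrightarrow> b \<in> carrier L \<Longrightarrow> map_poly f (lbr L a b) = lbr K (f a) (f b)"
    using iso by (auto simp: lca_isomorphic_def lca_hom_def)
  define g where "g = inv_into (carrier L) f"
  have g: "bij_betw g (carrier K) (carrier L)"
    unfolding g_def using f(2) by (rule bij_betw_inv_into)
  have gf: "g (f a) = a" if "a \<in> carrier L" for a
    unfolding g_def using f(2) that by (rule bij_betw_inv_into_left)
  have K: "\<exists>a\<in>carrier L. u = f a" if "u \<in> carrier K" for u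
    using f(2) that by (auto simp: bij_betw_def)
  note S = carrier_subspace
  have f0: "f 0 = 0"
    using f(1) subspace_0[OF S] by (rule cd_hom_zero)
  have g0: "g 0 = 0"
    using gf[OF subspace_0[OF S]] f0 by simp
  have add: "g (u + v) = g u + g v" if "u \<in> carrier K" "v \<in> carrier K" for u v
  proof -
    obtain a b where "a \<in> carrier L" "u = f a" "b \<in> carrier L" "v = f b"
      using K \<open>u \<in> carrier K\<close> \<open>v \<in> carrier K\<close> by blast
    moreover from this have "f (a + b) = f a + f b"
      using f(1) by (simp add: cd_hom_def)
    ultimately show ?thesis
      using gf subspace_add[OF S, of a b] by metis
  qed
  have scl: "g (scal K s u) = scal L s (g u)" if "u \<in> carrier K" for s u
  proof -
    obtain a where "a \<in> carrier L" "u = f a"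
      using K \<open>u \<in> carrier K\<close> by blast
    moreover from this have "f (scal L s a) = scal K s (f a)"
      using f(1) by (simp add: cd_hom_def)
    ultimately show ?thesis
      using gf subspace_scale[OF S, of a s] by metis
  qed
  have dr: "g (der K u) = der L (g u)" if "u \<in> carrier K" for u
  proof -
    obtain a where "a \<in> carrier L" "u = f a"
      using K \<open>u \<in> carrier K\<close> by blast
    moreover from this have "f (der L a) = der K (f a)"
      using f(1) by (simp add: cd_hom_def)
    ultimately show ?thesis
      using gf der_closed[of a] by metis
  qed
  have "map_poly g (lbr K u v) = lbr L (g u) (g v)" if "u \<in> carrier K" "v \<in> carrier K" for u v
  proof -
    obtain a b where ab: "a \<in> carrier L" "u = f a" "b \<in> carrier L" "v = f b"
      using K \<open>u \<in> carrier K\<close> \<open>v \<in> carrier K\<close> by blast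
    have "map_poly g (map_poly f (lbr L a b)) = lbr L a b"
      by (rule poly_eqI) (simp add: coeff_map_poly f0 g0 gf lbr_closed ab)
    then show ?thesis
      using ab by (simp add: br gf)
  qed
  then have "lca_hom K L g"
    using bij_betwE[OF g] add scl dr by (simp add: lca_hom_def cd_hom_def)
  with g show ?thesis by (auto simp: lca_isomorphic_def)
qed

section \<open>The substitution of \<open>-\<lambda>-\<partial>\<close>\<close>

definition polys_over :: "'a::zero set \<Rightarrow> 'a poly set" where
  "polys_over S = {p. \<forall>n. coeff p n \<in> S}"

lemma polys_overD: "p \<in> polys_over S \<Longrightarrow> coeff p n \<in> S"
  by (simp add: polys_over_def)

lemma polys_over_mono: "S \<subseteq> T \<Longrightarrow> p \<in> polys_over S \<Longrightarrow> p \<in> polys_over T"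
  by (auto simp: polys_over_def)

context vector_space
begin

lemma polys_over_add: "subspace S \<Longrightarrow> p \<in> polys_over S \<Longrightarrow> q \<in> polys_over S \<Longrightarrow> p + q \<in> polys_over S"
  by (simp add: polys_over_def subspace_add)

lemma polys_over_diff: "subspace S \<Longrightarrow> p \<in> polys_over S \<Longrightarrow> q \<in> polys_over S \<Longrightarrow> p - q \<in> polys_over S"
  by (simp add: polys_over_def subspace_diff)

lemma polys_over_sum:
  "subspace S \<Longrightarrow> (\<And>n. n \<in> A \<Longrightarrow> f n \<in> polys_over S) \<Longrightarrow> sum f A \<in> polys_over S"
  by (simp add: polys_over_def coeff_sum subspace_sum)

end

text \<open>Multiplication by \<open>-\<lambda>-\<partial>\<close>, the operator whose powers occur in \<open>flip\<close>.\<close>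

definition flip_step :: "('a::ab_group_add \<Rightarrow> 'a) \<Rightarrow> 'a poly \<Rightarrow> 'a poly" where
  "flip_step d q = - pCons 0 q - map_poly d q"

context cd_module
begin

lemma der_0: "der M 0 = 0"
proof -
  have "der M (0 + 0) = der M 0 + der M 0"
    using subspace_0[OF carrier_subspace] der_add by blast
  then show ?thesis by simp
qed

lemma coeff_flip_step:
  "coeff (flip_step (der M) q) n = - (case n of 0 \<Rightarrow> 0 | Suc m \<Rightarrow> coeff q m) - der M (coeff q n)"
  by (simp add: flip_step_def coeff_map_poly der_0 coeff_pCons split: nat.split)

lemma flip_step_polys_over:
  assumes "subspace S" "\<And>a. a \<in> S \<Longrightarrow> der M a \<in> S" "q \<in> polys_over S"
  shows "flip_step (der M) q \<in> polys_over S"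
  using assms
  by (auto simp: polys_over_def coeff_flip_step subspace_0 subspace_neg subspace_diff split: nat.split)

lemma flip_step_add:
  assumes "p \<in> polys_over (carrier M)" "q \<in> polys_over (carrier M)"
  shows "flip_step (der M) (p + q) = flip_step (der M) p + flip_step (der M) q"
  using assms
  by (intro poly_eqI) (simp add: coeff_flip_step der_add polys_overD split: nat.split)

lemma flip_step_power_polys_over:
  assumes "subspace S" "\<And>a. a \<in> S \<Longrightarrow> der M a \<in> S" "w \<in> S"
  shows "(flip_step (der M) ^^ n) [:w:] \<in> polys_over S"
proof (induction n)
  case 0
  show ?case using assms by (auto simp: polys_over_def coeff_pCons subspace_0 split: nat.split)
qed (simp add: flip_step_polys_over assms)

lemma flip_step_power_add:
  assumes "v \<in> carrier M" "w \<in> carrier M"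
  shows "(flip_step (der M) ^^ n) [:v + w:] = (flip_step (der M) ^^ n) [:v:] + (flip_step (der M) ^^ n) [:w:]"
  by (induction n)
    (simp_all add: flip_step_add flip_step_power_polys_over carrier_subspace der_closed assms)

lemma flip_step_power_0: "(flip_step (der M) ^^ n) 0 = 0"
  by (induction n) (simp_all add: flip_step_def)

text \<open>
  The sum that defines the substitution stops at the degree, which is not additive; a common upper
  bound serves for several polynomials at once.
\<close>

lemma flip_eq_sum:
  assumes "degree p \<le> N"
  shows "flip (der M) p = (\<Sum>n\<le>N. (flip_step (der M) ^^ n) [:coeff p n:])"
proof -
  have "flip (der M) p = (\<Sum>n\<le>degree p. (flip_step (der M) ^^ n) [:coeff p n:])"
    by (simp add: flip_def psub_def flip_step_def[abs_def])
  also have "\<dots> = (\<Sum>n\<le>N. (flip_step (der M) ^^ n) [:coeff p n:])"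
    using assms by (intro sum.mono_neutral_left) (auto simp: coeff_eq_0 flip_step_power_0)
  finally show ?thesis .
qed

lemma flip_polys_over:
  assumes "subspace S" "\<And>a. a \<in> S \<Longrightarrow> der M a \<in> S" "p \<in> polys_over S"
  shows "flip (der M) p \<in> polys_over S"
  unfolding flip_eq_sum[OF order_refl]
  by (intro polys_over_sum flip_step_power_polys_over assms polys_overD)

lemma flip_add:
  assumes "p \<in> polys_over (carrier M)" "q \<in> polys_over (carrier M)"
  shows "flip (der M) (p + q) = flip (der M) p + flip (der M) q"
proof -
  let ?N = "max (degree p) (degree q)"
  show ?thesis
    using assms
    by (simp add: flip_eq_sum[of _ ?N] degree_add_le flip_step_power_add polys_overD sum.distrib)
qed

end

section \<open>The bicrossed product\<close>

lemma lie_conformal_algebra_restr: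
  assumes "lie_conformal_algebra E" "subalgebra S E"
  shows "lie_conformal_algebra (restr E S)"
proof -
  interpret lie_conformal_algebra E by (rule assms)
  have S: "S \<subseteq> carrier E" "subspace S" "\<And>a. a \<in> S \<Longrightarrow> der E a \<in> S"
    "\<And>a b n. a \<in> S \<Longrightarrow> b \<in> S \<Longrightarrow> coeff (lbr E a b) n \<in> S"
    using assms(2) by (auto simp: subalgebra_def)
  have restr: "carrier (restr E S) = S" "scal (restr E S) = scal E" "der (restr E S) = der E"
    "lbr (restr E S) = lbr E"
    by (simp_all add: restr_def)
  show ?thesis
    unfolding lie_conformal_algebra_def cd_module_def cd_module_axioms_def
      lie_conformal_algebra_axioms_def restr
    using S vector_space_axioms
    by (intro conjI allI impI)
      (blast intro: der_add der_scal lbr_add_left lbr_add_right lbr_scal_left lbr_scal_right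
        lbr_der_left lbr_der_right lbr_skew lbr_jacobi)+
qed

locale split_lca = lie_conformal_algebra E for E :: "'a::ab_group_add lca" +
  fixes R Q :: "'a set"
  assumes R_subalgebra: "subalgebra R E" and Q_complement: "complement E R Q"
begin

abbreviation "rhd \<equiv> mp_rhd E R Q"
abbreviation "lhd \<equiv> mp_lhd E R Q"
abbreviation "fl \<equiv> flip (der E)"

lemma Q_subalgebra: "subalgebra Q E"
  using Q_complement by (simp add: complement_def)

lemma subspace_R: "subspace R" and subspace_Q: "subspace Q"
  using R_subalgebra Q_subalgebra by (simp_all add: subalgebra_def)

lemma R_carrier: "R \<subseteq> carrier E" and Q_carrier: "Q \<subseteq> carrier E"
  using R_subalgebra Q_subalgebra by (simp_all add: subalgebra_def)

lemma der_R: "a \<in> R \<Longrightarrow> der E a \<in> R" and der_Q: "x \<in> Q \<Longrightarrow> der E x \<in> Q"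
  using R_subalgebra Q_subalgebra by (simp_all add: subalgebra_def)

lemma lbr_R: "a \<in> R \<Longrightarrow> b \<in> R \<Longrightarrow> lbr E a b \<in> polys_over R"
  and lbr_Q: "x \<in> Q \<Longrightarrow> y \<in> Q \<Longrightarrow> lbr E x y \<in> polys_over Q"
  using R_subalgebra Q_subalgebra by (simp_all add: subalgebra_def polys_over_def)

lemma decomposition_unique:
  assumes "a \<in> R" "x \<in> Q" "b \<in> R" "y \<in> Q" "a + x = b + y"
  shows "a = b" "x = y"
proof -
  have "a - b = y - x" using assms(5) by (simp add: algebra_simps)
  moreover have "a - b \<in> R" "y - x \<in> Q"
    using assms subspace_R subspace_Q by (auto intro: subspace_diff)
  ultimately have "a - b \<in> R \<inter> Q" by simp
  moreover have "R \<inter> Q = {0}" using Q_complement by (simp add: complement_def)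
  ultimately have "a - b = 0" by blast
  with assms(5) show "a = b" "x = y" by simp_all
qed

lemma sum_carrier: "a \<in> R \<Longrightarrow> x \<in> Q \<Longrightarrow> a + x \<in> carrier E"
  using R_carrier Q_carrier carrier_subspace by (auto intro: subspace_add)

lemma dproj_Q_sum:
  assumes "a \<in> R" "x \<in> Q"
  shows "dproj Q R (a + x) = x"
proof -
  note D = dproj_decomp[OF subspace_R vector_space_axioms Q_complement sum_carrier[OF assms]]
  show ?thesis
    using decomposition_unique(2)[OF D(1,2) assms D(3)] .
qed

lemma rhd_lhd_polys_over:
  assumes "x \<in> Q" "a \<in> R"
  shows "rhd x a \<in> polys_over R" "lhd x a \<in> polys_over Q"
    "fl (rhd x a) \<in> polys_over R" "fl (lhd x a) \<in> polys_over Q"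
proof -
  note md = matched_pair_decomp[OF lie_conformal_algebra_axioms R_subalgebra Q_complement assms]
  show p: "rhd x a \<in> polys_over R" "lhd x a \<in> polys_over Q"
    using md by (simp_all add: polys_over_def)
  show "fl (rhd x a) \<in> polys_over R" "fl (lhd x a) \<in> polys_over Q"
    using p by (auto intro: flip_polys_over subspace_R subspace_Q der_R der_Q)
qed

text \<open>
  Skew-symmetry reduces the remaining mixed bracket \<open>[a\<^sub>\<lambda>y]\<close>, with the element of \<open>R\<close> on the left, to
  the one that defines the matched pair.
\<close>

lemma bicrossed_bracket:
  assumes "a \<in> R" "b \<in> R" "x \<in> Q" "y \<in> Q"
  shows "lbr E (a + x) (b + y) =
    (lbr E a b + rhd x b - fl (rhd y a)) + (lbr E x y + lhd x b - fl (lhd y a))"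
proof -
  have c: "a \<in> carrier E" "b \<in> carrier E" "x \<in> carrier E" "y \<in> carrier E" "b + y \<in> carrier E"
    using assms R_carrier Q_carrier sum_carrier by auto
  note md = matched_pair_decomp(3)[OF lie_conformal_algebra_axioms R_subalgebra Q_complement]
  have "lbr E a y = - fl (rhd y a + lhd y a)"
    using lbr_skew[OF c(1,4)] md assms by simp
  also have "\<dots> = - (fl (rhd y a) + fl (lhd y a))"
    using rhd_lhd_polys_over[OF assms(4,1)] R_carrier Q_carrier
    by (simp add: flip_add polys_over_mono)
  finally have ay: "lbr E a y = - (fl (rhd y a) + fl (lhd y a))" .
  have "lbr E (a + x) (b + y) = lbr E a b + lbr E a y + (lbr E x b + lbr E x y)"
    using c by (simp add: lbr_add_left lbr_add_right)
  then show ?thesis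
    using md assms by (simp add: ay algebra_simps)
qed

section \<open>Graphs of module homomorphisms\<close>

definition graph :: "('a \<Rightarrow> 'a) \<Rightarrow> 'a set" where
  "graph \<phi> = (\<lambda>x. \<phi> x + x) ` Q"

abbreviation QR_hom :: "('a \<Rightarrow> 'a) \<Rightarrow> bool" where
  "QR_hom \<phi> \<equiv> cd_hom (restr E Q) (restr E R) \<phi>"

definition defbr :: "('a \<Rightarrow> 'a) \<Rightarrow> 'a \<Rightarrow> 'a \<Rightarrow> 'a poly" where
  "defbr \<phi> x y = lbr E x y + lhd x (\<phi> y) - fl (lhd y (\<phi> x))"

text \<open>The component in \<open>R[\<lambda>]\<close> of the bracket \<open>[(\<phi> x + x)\<^sub>\<lambda> (\<phi> y + y)]\<close>.\<close>

definition graphbr_R :: "('a \<Rightarrow> 'a) \<Rightarrow> 'a \<Rightarrow> 'a \<Rightarrow> 'a poly" where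
  "graphbr_R \<phi> x y = lbr E (\<phi> x) (\<phi> y) + rhd x (\<phi> y) - fl (rhd y (\<phi> x))"

lemma deformed_simps:
  "carrier (deformed E R Q \<phi>) = Q" "scal (deformed E R Q \<phi>) = scal E"
  "der (deformed E R Q \<phi>) = der E" "lbr (deformed E R Q \<phi>) = defbr \<phi>"
  by (simp_all add: deformed_def defbr_def[abs_def])

lemma QR_hom_iff:
  "QR_hom \<phi> \<longleftrightarrow> (\<forall>x\<in>Q. \<phi> x \<in> R) \<and> (\<forall>x\<in>Q. \<forall>y\<in>Q. \<phi> (x + y) = \<phi> x + \<phi> y) \<and>
    (\<forall>s. \<forall>x\<in>Q. \<phi> (scal E s x) = scal E s (\<phi> x)) \<and> (\<forall>x\<in>Q. \<phi> (der E x) = der E (\<phi> x))"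
  by (simp add: cd_hom_def restr_def)

context
  fixes \<phi> :: "'a \<Rightarrow> 'a"
  assumes hom: "QR_hom \<phi>"
begin

lemma hom_R: "x \<in> Q \<Longrightarrow> \<phi> x \<in> R"
  and hom_add: "x \<in> Q \<Longrightarrow> y \<in> Q \<Longrightarrow> \<phi> (x + y) = \<phi> x + \<phi> y"
  and hom_scal: "x \<in> Q \<Longrightarrow> \<phi> (scal E s x) = scal E s (\<phi> x)"
  and hom_der: "x \<in> Q \<Longrightarrow> \<phi> (der E x) = der E (\<phi> x)"
  using hom by (simp_all add: QR_hom_iff)

lemma hom_0: "\<phi> 0 = 0"
  using cd_hom_zero[OF hom] subspace_0[OF subspace_Q] by (simp add: restr_def)

lemma hom_diff: "x \<in> Q \<Longrightarrow> y \<in> Q \<Longrightarrow> \<phi> (x - y) = \<phi> x - \<phi> y"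
  using hom_add[of "x - y" y] subspace_diff[OF subspace_Q, of x y] by (simp add: algebra_simps)

lemma dproj_graph: "x \<in> Q \<Longrightarrow> dproj Q R (\<phi> x + x) = x"
  by (simp add: dproj_Q_sum hom_R)

lemma sum_in_graph_iff:
  assumes "a \<in> R" "x \<in> Q"
  shows "a + x \<in> graph \<phi> \<longleftrightarrow> a = \<phi> x"
proof
  assume "a + x \<in> graph \<phi>"
  then obtain y where "y \<in> Q" "a + x = \<phi> y + y"
    by (auto simp: graph_def)
  with decomposition_unique[OF assms hom_R this(1)] show "a = \<phi> x" by metis
qed (use assms in \<open>auto simp: graph_def\<close>)

lemma graph_subspace: "subspace (graph \<phi>)"
proof (rule subspaceI)
  show "0 \<in> graph \<phi>"
    using sum_in_graph_iff[of 0 0] by (simp add: hom_0 subspace_0 subspace_R subspace_Q)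
next
  fix u v assume "u \<in> graph \<phi>" "v \<in> graph \<phi>"
  then obtain x y where xy: "x \<in> Q" "u = \<phi> x + x" "y \<in> Q" "v = \<phi> y + y"
    by (auto simp: graph_def)
  then have "u + v = \<phi> (x + y) + (x + y)"
    by (simp add: hom_add algebra_simps)
  then show "u + v \<in> graph \<phi>"
    using subspace_add[OF subspace_Q xy(1,3)] by (simp add: graph_def)
next
  fix s u assume "u \<in> graph \<phi>"
  then obtain x where x: "x \<in> Q" "u = \<phi> x + x"
    by (auto simp: graph_def)
  then have "scal E s u = \<phi> (scal E s x) + scal E s x"
    by (simp add: hom_scal scale_right_distrib)
  then show "scal E s u \<in> graph \<phi>"
    using subspace_scale[OF subspace_Q x(1)] by (simp add: graph_def)
qed

lemma der_graph_point: "x \<in> Q \<Longrightarrow> der E (\<phi> x + x) = \<phi> (der E x) + der E x"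
  using der_add[of "\<phi> x" x] hom_R[of x] R_carrier Q_carrier by (auto simp: hom_der)

lemma graph_der: "u \<in> graph \<phi> \<Longrightarrow> der E u \<in> graph \<phi>"
  by (auto simp: graph_def der_graph_point der_Q)

lemma graph_direct_sum:
  "carrier E = {a + u |a u. a \<in> R \<and> u \<in> graph \<phi>}" "R \<inter> graph \<phi> = {0}"
proof -
  have "\<exists>b u. a + x = b + u \<and> b \<in> R \<and> u \<in> graph \<phi>" if "a \<in> R" "x \<in> Q" for a x
    using that
    by (intro exI[of _ "a - \<phi> x"] exI[of _ "\<phi> x + x"])
      (auto simp: graph_def hom_R intro: subspace_diff[OF subspace_R])
  moreover have "\<exists>b y. a + u = b + y \<and> b \<in> R \<and> y \<in> Q" if "a \<in> R" "u \<in> graph \<phi>" for a u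
  proof -
    obtain x where "x \<in> Q" "u = \<phi> x + x"
      using \<open>u \<in> graph \<phi>\<close> by (auto simp: graph_def)
    with that show ?thesis
      by (intro exI[of _ "a + \<phi> x"] exI[of _ x]) (auto simp: hom_R add.assoc intro: subspace_add[OF subspace_R])
  qed
  ultimately show "carrier E = {a + u |a u. a \<in> R \<and> u \<in> graph \<phi>}"
    using Q_complement by (auto simp: complement_def)
  have "a \<in> graph \<phi> \<longleftrightarrow> a = 0" if "a \<in> R" for a
    using sum_in_graph_iff[OF that subspace_0[OF subspace_Q]] by (simp add: hom_0)
  then show "R \<inter> graph \<phi> = {0}"
    using subspace_0[OF subspace_R] by auto
qed

lemma graph_carrier: "graph \<phi> \<subseteq> carrier E"
  by (auto simp: graph_def hom_R sum_carrier)

lemma graph_components: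
  assumes "x \<in> Q" "y \<in> Q"
  shows "graphbr_R \<phi> x y \<in> polys_over R" "defbr \<phi> x y \<in> polys_over Q"
  using assms unfolding graphbr_R_def defbr_def
  by (auto intro!: polys_over_add polys_over_diff subspace_R subspace_Q lbr_R lbr_Q
      rhd_lhd_polys_over hom_R)

lemma graph_bracket:
  assumes "x \<in> Q" "y \<in> Q"
  shows "lbr E (\<phi> x + x) (\<phi> y + y) = graphbr_R \<phi> x y + defbr \<phi> x y"
  using assms by (simp add: bicrossed_bracket hom_R graphbr_R_def defbr_def)

text \<open>
  The equation of a deformation map, with the terms to which \<open>\<phi>\<close> is applied collected on one side:
  together they are \<open>\<phi>([x\<^sub>\<lambda>y]\<^sub>\<phi>)\<close>, and the others form the component of the graph bracket in \<open>R[\<lambda>]\<close>.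
\<close>

lemma deformation_map_iff:
  "deformation_map E R Q \<phi> \<longleftrightarrow> (\<forall>x\<in>Q. \<forall>y\<in>Q. map_poly \<phi> (defbr \<phi> x y) = graphbr_R \<phi> x y)"
proof -
  have "map_poly \<phi> (defbr \<phi> x y) =
      map_poly \<phi> (lbr E x y) + map_poly \<phi> (lhd x (\<phi> y)) - map_poly \<phi> (fl (lhd y (\<phi> x)))"
    if "x \<in> Q" "y \<in> Q" for x y
    using polys_overD[OF lbr_Q[of x y]] polys_overD[OF rhd_lhd_polys_over(2)[of x "\<phi> y"]]
      polys_overD[OF rhd_lhd_polys_over(4)[of y "\<phi> x"]] that hom_R
    by (intro poly_eqI)
      (simp add: defbr_def coeff_map_poly hom_0 hom_diff hom_add subspace_add[OF subspace_Q])
  moreover have "p - a = q - l + r - s \<longleftrightarrow> p + l - q = a + r - s" for p q l a r s :: "'a poly"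
    by (auto simp: algebra_simps)
  ultimately show ?thesis
    using hom by (simp add: deformation_map_def graphbr_R_def)
qed

text \<open>
  The two components of \<open>[(\<phi> x + x)\<^sub>\<lambda>(\<phi> y + y)]\<close> are unique, so its coefficients lie on the graph
  exactly when \<open>\<phi>\<close> takes the component in \<open>Q[\<lambda>]\<close> to the one in \<open>R[\<lambda>]\<close>.
\<close>

lemma complement_graph_iff: "complement E R (graph \<phi>) \<longleftrightarrow> deformation_map E R Q \<phi>"
proof -
  have closed: "(\<forall>n. coeff (lbr E (\<phi> x + x) (\<phi> y + y)) n \<in> graph \<phi>) \<longleftrightarrow>
      map_poly \<phi> (defbr \<phi> x y) = graphbr_R \<phi> x y" if "x \<in> Q" "y \<in> Q" for x y
    using graph_components[OF that] that
    by (simp add: graph_bracket polys_over_def sum_in_graph_iff poly_eq_iff coeff_map_poly hom_0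
        eq_commute)
  have "complement E R (graph \<phi>) \<longleftrightarrow> subalgebra (graph \<phi>) E"
    using graph_direct_sum by (simp add: complement_def)
  also have "\<dots> \<longleftrightarrow> (\<forall>u\<in>graph \<phi>. \<forall>v\<in>graph \<phi>. \<forall>n. coeff (lbr E u v) n \<in> graph \<phi>)"
    using graph_carrier graph_subspace graph_der by (simp add: subalgebra_def)
  also have "\<dots> \<longleftrightarrow> (\<forall>x\<in>Q. \<forall>y\<in>Q. \<forall>n. coeff (lbr E (\<phi> x + x) (\<phi> y + y)) n \<in> graph \<phi>)"
    unfolding graph_def by blast
  also have "\<dots> \<longleftrightarrow> deformation_map E R Q \<phi>"
    by (simp add: closed deformation_map_iff)
  finally show ?thesis .
qed

text \<open>
  The isomorphism is the projection to \<open>Q\<close> along \<open>R\<close>, the inverse of \<open>x \<mapsto> \<phi> x + x\<close>. On the bracket of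
  two points of the graph it keeps just the component in \<open>Q[\<lambda>]\<close>, which is the bracket of \<open>Q\<^sub>\<phi>\<close>.
\<close>

lemma graph_isomorphic_deformed: "lca_isomorphic (restr E (graph \<phi>)) (deformed E R Q \<phi>)"
proof -
  let ?p = "dproj Q R"
  have pt: "\<exists>x\<in>Q. u = \<phi> x + x \<and> ?p u = x" if "u \<in> graph \<phi>" for u
    using that dproj_graph by (auto simp: graph_def)
  have p0: "?p 0 = 0"
    using dproj_graph[OF subspace_0[OF subspace_Q]] by (simp add: hom_0)
  have "?p (u + v) = ?p u + ?p v" if "u \<in> graph \<phi>" "v \<in> graph \<phi>" for u v
  proof -
    obtain x y where xy: "x \<in> Q" "u = \<phi> x + x" "?p u = x" "y \<in> Q" "v = \<phi> y + y" "?p v = y"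
      using pt[OF \<open>u \<in> graph \<phi>\<close>] pt[OF \<open>v \<in> graph \<phi>\<close>] by blast
    then have "u + v = \<phi> (x + y) + (x + y)" by (simp add: hom_add algebra_simps)
    then show ?thesis using xy dproj_graph subspace_add[OF subspace_Q] by metis
  qed
  moreover have "?p (scal E s u) = scal E s (?p u)" if "u \<in> graph \<phi>" for s u
  proof -
    obtain x where x: "x \<in> Q" "u = \<phi> x + x" "?p u = x"
      using pt[OF \<open>u \<in> graph \<phi>\<close>] by blast
    then have "scal E s u = \<phi> (scal E s x) + scal E s x"
      by (simp add: hom_scal scale_right_distrib)
    then show ?thesis using x dproj_graph subspace_scale[OF subspace_Q] by metis
  qed
  moreover have "?p (der E u) = der E (?p u)" if "u \<in> graph \<phi>" for u
    using pt[OF that] der_graph_point dproj_graph der_Q by metis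
  moreover have "map_poly ?p (lbr E u v) = defbr \<phi> (?p u) (?p v)"
    if "u \<in> graph \<phi>" "v \<in> graph \<phi>" for u v
  proof -
    obtain x y where xy: "x \<in> Q" "u = \<phi> x + x" "?p u = x" "y \<in> Q" "v = \<phi> y + y" "?p v = y"
      using pt[OF \<open>u \<in> graph \<phi>\<close>] pt[OF \<open>v \<in> graph \<phi>\<close>] by blast
    have "map_poly ?p (graphbr_R \<phi> x y + defbr \<phi> x y) = defbr \<phi> x y"
      using graph_components[OF xy(1,4)]
      by (intro poly_eqI) (simp add: coeff_map_poly p0 dproj_Q_sum polys_overD)
    with xy show ?thesis by (simp add: graph_bracket)
  qed
  moreover have "bij_betw ?p (graph \<phi>) Q"
    by (rule bij_betw_byWitness[where f' = "\<lambda>x. \<phi> x + x"]) (auto simp: graph_def dproj_graph)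
  moreover from this have "?p u \<in> Q" if "u \<in> graph \<phi>" for u
    using that by (auto simp: bij_betw_def)
  ultimately have "lca_hom (restr E (graph \<phi>)) (deformed E R Q \<phi>) ?p \<and>
      bij_betw ?p (carrier (restr E (graph \<phi>))) (carrier (deformed E R Q \<phi>))"
    by (simp add: lca_hom_def cd_hom_def deformed_simps restr_def)
  then show ?thesis unfolding lca_isomorphic_def by blast
qed

end

section \<open>Complements are graphs\<close>

text \<open>
  The witness is \<open>\<phi> x = - a\<close>, where \<open>x = a + u\<close> is the decomposition of \<open>x \<in> Q\<close> in \<open>R \<oplus> P\<close>, so that
  \<open>\<phi> x + x = u\<close> lies in \<open>P\<close>. It inherits linearity from the uniqueness of this element of \<open>R\<close>.
\<close>

lemma complement_is_graph:
  assumes P: "complement E R P"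
  obtains \<phi> where "QR_hom \<phi>" "P = graph \<phi>"
proof -
  interpret P: split_lca E R P
    using R_subalgebra P by unfold_locales
  define \<phi> where "\<phi> x = - dproj R P x" for x
  have \<phi>: "\<phi> x \<in> R" "\<phi> x + x \<in> P" if "x \<in> Q" for x
  proof -
    have "x \<in> carrier E" using that Q_carrier by blast
    note D = dproj_decomp[OF subspace_R vector_space_axioms P this]
    show "\<phi> x \<in> R" unfolding \<phi>_def using D(1) subspace_R by (rule subspace_neg[rotated])
    have "\<phi> x + x = dproj P R x" unfolding \<phi>_def using D(3) by (metis minus_add_cancel)
    with D(2) show "\<phi> x + x \<in> P" by simp
  qed
  have unique: "a = \<phi> x" if "x \<in> Q" "a \<in> R" "a + x \<in> P" for a x
  proof -
    have "- a = - \<phi> x"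
    proof (rule P.decomposition_unique(1))
      show "- a + (a + x) = - \<phi> x + (\<phi> x + x)" by simp
    qed (use that \<phi> in \<open>auto intro: subspace_neg subspace_R\<close>)
    then show ?thesis by simp
  qed
  have "QR_hom \<phi>"
    unfolding QR_hom_iff
  proof (intro conjI ballI allI)
    show "\<phi> x \<in> R" if "x \<in> Q" for x
      using that by (rule \<phi>)
    show "\<phi> (x + y) = \<phi> x + \<phi> y" if xy: "x \<in> Q" "y \<in> Q" for x y
    proof (rule unique[symmetric])
      have "\<phi> x + \<phi> y + (x + y) = (\<phi> x + x) + (\<phi> y + y)" by (simp add: algebra_simps)
      then show "\<phi> x + \<phi> y + (x + y) \<in> P"
        using subspace_add[OF P.subspace_Q \<phi>(2)[OF xy(1)] \<phi>(2)[OF xy(2)]] by (simp only:)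
    qed (auto intro: subspace_add subspace_Q subspace_R \<phi> xy)
    show "\<phi> (scal E s x) = scal E s (\<phi> x)" if x: "x \<in> Q" for s x
    proof (rule unique[symmetric])
      show "scal E s (\<phi> x) + scal E s x \<in> P"
        using subspace_scale[OF P.subspace_Q \<phi>(2)[OF x], of s] by (simp add: scale_right_distrib)
    qed (auto intro: subspace_scale subspace_Q subspace_R \<phi> x)
    show "\<phi> (der E x) = der E (\<phi> x)" if x: "x \<in> Q" for x
    proof (rule unique[symmetric])
      have "der E (\<phi> x + x) = der E (\<phi> x) + der E x"
        using \<phi>(1)[OF x] x R_carrier Q_carrier by (intro der_add) auto
      then show "der E (\<phi> x) + der E x \<in> P"
        using P.der_Q[OF \<phi>(2)[OF x]] by simp
    qed (auto intro: der_R der_Q \<phi> x)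
  qed
  moreover have "P = graph \<phi>"
  proof
    show "graph \<phi> \<subseteq> P" using \<phi> by (auto simp: graph_def)
    show "P \<subseteq> graph \<phi>"
    proof
      fix u assume u: "u \<in> P"
      then obtain a x where ax: "a \<in> R" "x \<in> Q" "u = a + x"
        using P.Q_carrier Q_complement by (auto simp: complement_def)
      with u have "a = \<phi> x" by (intro unique) auto
      with ax show "u \<in> graph \<phi>" by (simp add: graph_def)
    qed
  qed
  ultimately show ?thesis by (rule that)
qed

end

theorem theorem3p10:
  fixes E :: "'a::ab_group_add lca" and R Q :: "'a set"
    and Qbar :: "'b::ab_group_add lca"
  assumes "lie_conformal_algebra E"
    and "subalgebra R E"
    and "complement E R Q"
    and "lie_conformal_algebra Qbar"
  shows "is_complement_of Qbar R E \<longleftrightarrow>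
    (\<exists>\<phi>. deformation_map E R Q \<phi> \<and> lca_isomorphic Qbar (deformed E R Q \<phi>))"
proof
  interpret split_lca E R Q
    using assms by (simp add: split_lca_def split_lca_axioms_def)
  interpret Qbar: lie_conformal_algebra Qbar by (rule assms(4))
  have Qbar0: "0 \<in> carrier Qbar"
    using Qbar.carrier_subspace by (rule Qbar.subspace_0)
  show "\<exists>\<phi>. deformation_map E R Q \<phi> \<and> lca_isomorphic Qbar (deformed E R Q \<phi>)"
    if L: "is_complement_of Qbar R E"
  proof -
    obtain P where P: "complement E R P" "lca_isomorphic Qbar (restr E P)"
      using L by (auto simp: is_complement_of_def)
    obtain \<phi> where \<phi>: "QR_hom \<phi>" "P = graph \<phi>"
      using P(1) by (rule complement_is_graph)
    have "deformation_map E R Q \<phi>"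
      using complement_graph_iff[OF \<phi>(1)] P(1) \<phi>(2) by simp
    moreover have "lca_isomorphic Qbar (deformed E R Q \<phi>)"
      using P(2) graph_isomorphic_deformed[OF \<phi>(1)] Qbar0
      unfolding \<phi>(2) by (rule lca_isomorphic_trans)
    ultimately show ?thesis by blast
  qed
  show "is_complement_of Qbar R E"
    if L: "\<exists>\<phi>. deformation_map E R Q \<phi> \<and> lca_isomorphic Qbar (deformed E R Q \<phi>)"
  proof -
    obtain \<phi> where \<phi>: "deformation_map E R Q \<phi>" "lca_isomorphic Qbar (deformed E R Q \<phi>)"
      using L by blast
    have hom: "QR_hom \<phi>"
      using \<phi>(1) by (simp add: deformation_map_def)
    have C: "complement E R (graph \<phi>)"
      using complement_graph_iff[OF hom] \<phi>(1) by simp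
    then have "lie_conformal_algebra (restr E (graph \<phi>))"
      using assms(1) by (simp add: lie_conformal_algebra_restr complement_def)
    then have "lca_isomorphic (deformed E R Q \<phi>) (restr E (graph \<phi>))"
      using graph_isomorphic_deformed[OF hom] by (rule lca_isomorphic_sym)
    with \<phi>(2) have "lca_isomorphic Qbar (restr E (graph \<phi>))"
      using Qbar0 by (rule lca_isomorphic_trans)
    with C show ?thesis by (auto simp: is_complement_of_def)
  qed
qed

end
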